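(* Let $R$ be an integral domain. The following conditions are equivalent: (i) $R$ is $w$-stable; (ii) each $w$-ideal $I$ of $R$ is a divisorial ideal of the domain $E(I)$, i.e. $(E(I):(E(I):I))=I$; (iii) $R$ has $t$-finite character and $R_M$ is a stable domain for each $t$-maximal ideal $M$ of $R$.
   Context: $R$ is an integral domain with quotient field $K\neq R$. For nonzero $R$-submodules $A,B$ of $K$, $(A:B)=\{x\in K: xB\subseteq A\}$; for a nonzero ideal $I$, $E(I)=(I:I)$. For a nonzero fractional ideal $I$, $I_v=(R:(R:I))$, $I_t=\bigcup\{J_v: J\subseteq I\text{ nonzero finitely generated}\}$; $t\text{-Max}(R)$ is the set of ideals maximal among proper $t$-ideals (ideals with $I=I_t$). For a nonzero $R$-submodule $E$ of $K$, $E_w=\bigcap_{M\in t\text{-Max}(R)}ER_M$; $I$ is a $w$-ideal if $I=I_w$. A $w$-ideal $I$ is $w$-stable if $(I(E(I):I))_w=E(I)$, and $R$ is $w$-stable if every $w$-ideal is $w$-stable. $R$ has $t$-finite character if each nonzero element lies in only finitely many $t$-maximal ideals. A domain $D$ is stable if every nonzero ideal $I$ of $D$ is invertible in the overring $(I:I)$, i.e. $I((I:I):I)=(I:I)$. *)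

theory Defs
  imports Main
begin

text \<open>The quotient field K is modelled as the whole of a type 'a of class field;
  the integral domain R is a subring of it whose fraction field is all of 'a.\<close>

definition subring :: "'a::field set \<Rightarrow> bool" where
  "subring R \<longleftrightarrow> 0 \<in> R \<and> 1 \<in> R \<and> (\<forall>x\<in>R. \<forall>y\<in>R. x + y \<in> R \<and> x - y \<in> R \<and> x * y \<in> R)"

definition is_quotient_field :: "'a::field set \<Rightarrow> bool" where
  "is_quotient_field R \<longleftrightarrow> (\<forall>x. \<exists>a\<in>R. \<exists>b\<in>R. b \<noteq> 0 \<and> x = a / b)"

definition submodule :: "'a::field set \<Rightarrow> 'a set \<Rightarrow> bool" where
  "submodule R A \<longleftrightarrow> 0 \<in> A \<and> (\<forall>x\<in>A. \<forall>y\<in>A. x + y \<in> A) \<and> (\<forall>r\<in>R. \<forall>x\<in>A. r * x \<in> A)"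

definition nonzero_submodule :: "'a::field set \<Rightarrow> 'a set \<Rightarrow> bool" where
  "nonzero_submodule R A \<longleftrightarrow> submodule R A \<and> A \<noteq> {0}"

definition nz_ideal :: "'a::field set \<Rightarrow> 'a set \<Rightarrow> bool" where
  "nz_ideal R I \<longleftrightarrow> nonzero_submodule R I \<and> I \<subseteq> R"

definition colon :: "'a::field set \<Rightarrow> 'a set \<Rightarrow> 'a set" where
  "colon A B = {x. \<forall>b\<in>B. x * b \<in> A}"

definition Eend :: "'a::field set \<Rightarrow> 'a set" where
  "Eend I = colon I I"

definition mprod :: "'a::field set \<Rightarrow> 'a set \<Rightarrow> 'a set" where
  "mprod A B = {x. \<exists>(n::nat) f g. (\<forall>i<n. f i \<in> A \<and> g i \<in> B) \<and> x = (\<Sum>i<n. f i * g i)}"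

definition fg_span :: "'a::field set \<Rightarrow> 'a set \<Rightarrow> 'a set" where
  "fg_span R S = {x. \<exists>r. (\<forall>s\<in>S. r s \<in> R) \<and> x = (\<Sum>s\<in>S. r s * s)}"

definition vop :: "'a::field set \<Rightarrow> 'a set \<Rightarrow> 'a set" where
  "vop R I = colon R (colon R I)"

definition top_op :: "'a::field set \<Rightarrow> 'a set \<Rightarrow> 'a set" where
  "top_op R I = \<Union>{vop R J | J. \<exists>S. finite S \<and> S \<subseteq> I \<and> J = fg_span R S \<and> J \<noteq> {0}}"

definition proper_t_ideal :: "'a::field set \<Rightarrow> 'a set \<Rightarrow> bool" where
  "proper_t_ideal R I \<longleftrightarrow> nz_ideal R I \<and> I \<noteq> R \<and> top_op R I = I"

definition tMax :: "'a::field set \<Rightarrow> 'a set set" where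
  "tMax R = {M. proper_t_ideal R M \<and> (\<forall>N. proper_t_ideal R N \<and> M \<subseteq> N \<longrightarrow> N = M)}"

definition loc :: "'a::field set \<Rightarrow> 'a set \<Rightarrow> 'a set" where
  "loc R M = {x. \<exists>a\<in>R. \<exists>s\<in>R - M. x = a / s}"

definition wop :: "'a::field set \<Rightarrow> 'a set \<Rightarrow> 'a set" where
  "wop R E = (\<Inter>M\<in>tMax R. mprod E (loc R M))"

definition w_ideal :: "'a::field set \<Rightarrow> 'a set \<Rightarrow> bool" where
  "w_ideal R I \<longleftrightarrow> nz_ideal R I \<and> wop R I = I"

definition w_stable_ideal :: "'a::field set \<Rightarrow> 'a set \<Rightarrow> bool" where
  "w_stable_ideal R I \<longleftrightarrow> wop R (mprod I (colon (Eend I) I)) = Eend I"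

definition w_stable :: "'a::field set \<Rightarrow> bool" where
  "w_stable R \<longleftrightarrow> (\<forall>I. w_ideal R I \<longrightarrow> w_stable_ideal R I)"

definition t_finite_character :: "'a::field set \<Rightarrow> bool" where
  "t_finite_character R \<longleftrightarrow> (\<forall>x\<in>R. x \<noteq> 0 \<longrightarrow> finite {M \<in> tMax R. x \<in> M})"

definition stable_domain :: "'a::field set \<Rightarrow> bool" where
  "stable_domain D \<longleftrightarrow> (\<forall>I. nz_ideal D I \<longrightarrow> mprod I (colon (Eend I) I) = Eend I)"

end

theory Submission
  imports Defs
begin

text \<open>
  An ideal lies in no \<open>t\<close>-maximal ideal iff it contains a finite set \<open>S\<close> with \<open>(R : S) \<subseteq> R\<close>; hence
  \<open>t\<close>-maximal ideals are prime, the \<open>w\<close>-closure is computed locally, and an ideal \<open>I\<close> with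
  endomorphism ring \<open>E\<close> is \<open>w\<close>-stable iff \<open>I (E : I)\<close> meets the complement of every \<open>t\<close>-maximal ideal.

  (i) implies (ii) by multiplying with \<open>I (E : I)\<close>. Conversely, if \<open>I\<close> is divisorial in \<open>E\<close>, then
  \<open>J = I (E : I)\<close> satisfies \<open>(E : J) = E\<close>, so (ii) applied to a multiple of the \<open>w\<close>-closure of \<open>J\<close>
  shows that this closure is \<open>E\<close>.

  (iii) implies (i): local stability and finite character provide one finite set \<open>F \<subseteq> I\<close> that
  generates every localisation of \<open>I\<close> over its own endomorphism ring, and local inverses become
  global after clearing the denominators that occur on \<open>F\<close>.

  (i) implies local stability by contraction. For finite character, suppose \<open>x \<noteq> 0\<close> lies in
  infinitely many \<open>t\<close>-maximal ideals \<open>N\<close>, put \<open>B\<^sub>N = R + (N : N\<^sup>2)\<close>, and let \<open>I\<close> be the sum of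
  all \<open>x\<^sup>2 B\<^sub>N \<subseteq> R\<close>. By stability, \<open>I\<close> is generated over its endomorphism ring, up to
  \<open>w\<close>-closure, by finitely many elements. These lie in \<open>x\<^sup>2 R\<^sub>N\<close> for almost all \<open>N\<close>, which forces the
  localisation of \<open>B\<^sub>N\<close> at \<open>N\<close> to be a ring; but stability of \<open>N\<close> shows that it never is.
\<close>

section \<open>Sums of products, colons and finite spans\<close>

lemma mprodI: "a \<in> A \<Longrightarrow> b \<in> B \<Longrightarrow> a * b \<in> mprod A B"
  unfolding mprod_def
  by (intro CollectI exI[of _ "Suc 0"] exI[of _ "\<lambda>_. a"] exI[of _ "\<lambda>_. b"]) auto

lemma mprod_add:
  assumes "x \<in> mprod A B" "y \<in> mprod A B"
  shows "x + y \<in> mprod A B"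
proof -
  obtain n f g where 1: "\<forall>i<n. f i \<in> A \<and> g i \<in> B" "x = (\<Sum>i<n::nat. f i * g i)"
    using assms(1) unfolding mprod_def by auto
  obtain m f' g' where 2: "\<forall>i<m. f' i \<in> A \<and> g' i \<in> B" "y = (\<Sum>i<m::nat. f' i * g' i)"
    using assms(2) unfolding mprod_def by auto
  let ?h = "\<lambda>p q i. if i < n then p i else q (i - n)"
  have "(\<Sum>i<n+m. ?h f f' i * ?h g g' i) = x + y"
    unfolding 1(2) 2(2) by (induction m) (auto simp: add.assoc)
  moreover have "\<forall>i<n+m. ?h f f' i \<in> A \<and> ?h g g' i \<in> B"
    using 1(1) 2(1) by auto
  ultimately show ?thesis
    unfolding mprod_def by (intro CollectI exI[of _ "n + m"] exI[of _ "?h f f'"] exI[of _ "?h g g'"]) simp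
qed

text \<open>Induction on the number of summands. The partial sum \<open>y\<close> is also known to
  lie in the product, and \<open>P\<close> may mention fixed elements, so bilinear statements can be
  proved one factor at a time.\<close>

lemma mprod_induct [consumes 1, case_names zero add]:
  assumes "x \<in> mprod A B" and "P 0"
    and "\<And>a b y. a \<in> A \<Longrightarrow> b \<in> B \<Longrightarrow> y \<in> mprod A B \<Longrightarrow> P y \<Longrightarrow> P (y + a * b)"
  shows "P x"
proof -
  obtain n f g where fg: "\<forall>i<n. f i \<in> A \<and> g i \<in> B" "x = (\<Sum>i<n::nat. f i * g i)"
    using assms(1) unfolding mprod_def by auto
  have "(\<Sum>i<k. f i * g i) \<in> mprod A B \<and> P (\<Sum>i<k. f i * g i)" if "k \<le> n" for k
    using that
  proof (induction k)
    case 0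
    have "0 \<in> mprod A B" unfolding mprod_def by (intro CollectI exI[of _ 0]) simp
    then show ?case using assms(2) by simp
  next
    case (Suc k)
    then have "f k \<in> A" "g k \<in> B" using fg(1) by auto
    then show ?case using Suc assms(3) by (simp add: mprod_add mprodI)
  qed
  then show ?thesis using fg(2) by simp
qed

lemma zero_in_mprod: "0 \<in> mprod A B"
  unfolding mprod_def by (intro CollectI exI[of _ 0]) simp

lemma mprod_scale:
  assumes "x \<in> mprod A B" and "\<And>a. a \<in> A \<Longrightarrow> c * a \<in> A'"
  shows "c * x \<in> mprod A' B"
  using assms(1)
proof (induction rule: mprod_induct)
  case zero
  then show ?case by (simp add: zero_in_mprod)
next
  case (add a b y)
  then have "c * y + (c * a) * b \<in> mprod A' B"
    using assms(2) by (blast intro: mprod_add mprodI)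
  then show ?case by (simp add: algebra_simps)
qed

lemma mprod_subset:
  assumes "submodule R C" and "\<And>a b. a \<in> A \<Longrightarrow> b \<in> B \<Longrightarrow> a * b \<in> C"
  shows "mprod A B \<subseteq> C"
proof
  fix x assume "x \<in> mprod A B"
  then show "x \<in> C"
    by (induction rule: mprod_induct) (use assms in \<open>auto simp: submodule_def\<close>)
qed

lemma mprod_mono: "A \<subseteq> A' \<Longrightarrow> B \<subseteq> B' \<Longrightarrow> mprod A B \<subseteq> mprod A' B'"
  unfolding mprod_def by blast

lemma submodule_mprod:
  assumes "submodule R A"
  shows "submodule R (mprod A B)"
  using assms by (auto simp: submodule_def zero_in_mprod mprod_add intro: mprod_scale)

lemma submodule_colon: "submodule R A \<Longrightarrow> submodule R (colon A B)"
  unfolding submodule_def colon_def by (auto simp: algebra_simps)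

lemma subset_fg_span:
  assumes "subring R" "finite S"
  shows "S \<subseteq> fg_span R S"
proof
  fix s assume s: "s \<in> S"
  have "(\<Sum>u\<in>S. (if u = s then 1 else 0) * u) = (\<Sum>u\<in>S. if u = s then u else 0)"
    by (intro sum.cong) auto
  also have "\<dots> = s" using s assms(2) by simp
  finally show "s \<in> fg_span R S"
    unfolding fg_span_def using assms(1)
    by (intro CollectI exI[of _ "\<lambda>u. if u = s then 1 else 0"]) (auto simp: subring_def)
qed

text \<open>A multiplier is tested on generators. This lets the \<open>t\<close>-closure be
  described by finite sets instead of the modules they span.\<close>

lemma colon_fg_span:
  assumes "subring R" "finite S"
  shows "colon R (fg_span R S) = colon R S"
proof
  show "colon R (fg_span R S) \<subseteq> colon R S"
  proof
    fix y assume "y \<in> colon R (fg_span R S)"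
    then show "y \<in> colon R S" using subset_fg_span[OF assms] by (auto simp: colon_def)
  qed
  show "colon R S \<subseteq> colon R (fg_span R S)"
  proof
    fix y assume y: "y \<in> colon R S"
    have "y * (\<Sum>s\<in>S. r s * s) \<in> R" if r: "\<forall>s\<in>S. r s \<in> R" for r
    proof -
      have "(\<Sum>s\<in>T. r s * (y * s)) \<in> R" if "T \<subseteq> S" for T
        using finite_subset[OF that assms(2)] that
      proof (induction T rule: finite_induct)
        case empty
        then show ?case using assms(1) by (simp add: subring_def)
      next
        case (insert t T)
        then have "r t * (y * t) \<in> R" using r y assms(1) by (auto simp: colon_def subring_def)
        then show ?case using insert assms(1) by (auto simp: subring_def)
      qed
      from this[of S] show ?thesis by (simp add: sum_distrib_left mult.left_commute)
    qed
    then show "y \<in> colon R (fg_span R S)" by (auto simp: colon_def fg_span_def)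
  qed
qed

lemma fg_span_eq_zero_iff:
  assumes "subring R" "finite S"
  shows "fg_span R S = {0} \<longleftrightarrow> S \<subseteq> {0}"
proof
  assume "fg_span R S = {0}"
  then show "S \<subseteq> {0}" using subset_fg_span[OF assms] by blast
next
  assume "S \<subseteq> {0}"
  then have "(\<Sum>s\<in>S. r s * s) = 0" for r :: "'a \<Rightarrow> 'a" by (intro sum.neutral) auto
  moreover have "\<exists>r. \<forall>s\<in>S. r s \<in> R" using assms(1) by (auto simp: subring_def)
  ultimately show "fg_span R S = {0}" unfolding fg_span_def by auto
qed

section \<open>Density, the \<open>t\<close>-closure and \<open>t\<close>-maximal ideals\<close>

text \<open>This is the extension of \<open>E\<close> to the localisation at \<open>M\<close>,
  written with a single denominator instead of a sum of products; \<open>mprod_loc\<close> proves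
  that the two forms agree for a \<open>t\<close>-maximal \<open>M\<close>.\<close>

definition localize :: "'a::field set \<Rightarrow> 'a set \<Rightarrow> 'a set \<Rightarrow> 'a set" where
  "localize R M E = {x. \<exists>s\<in>R - M. s * x \<in> E}"

text \<open>For an ideal \<open>I\<close> this says that the \<open>t\<close>-closure of \<open>I\<close> is \<open>R\<close>.\<close>

definition contains_dense :: "'a::field set \<Rightarrow> 'a set \<Rightarrow> bool" where
  "contains_dense R I \<longleftrightarrow> (\<exists>S. finite S \<and> S \<subseteq> I \<and> colon R S \<subseteq> R)"

locale domain_with_fractions =
  fixes R :: "'a::field set"
  assumes subring: "subring R"
    and quotient_field: "is_quotient_field R"
    and not_field: "R \<noteq> UNIV"
begin

lemma zero_R [simp]: "0 \<in> R" and one_R [simp]: "1 \<in> R"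
  and add_R: "x \<in> R \<Longrightarrow> y \<in> R \<Longrightarrow> x + y \<in> R"
  and mult_R: "x \<in> R \<Longrightarrow> y \<in> R \<Longrightarrow> x * y \<in> R"
  using subring by (auto simp: subring_def)

lemma submodule_self: "submodule R R"
  by (simp add: submodule_def add_R mult_R)

lemma in_top_op_iff:
  "x \<in> top_op R I \<longleftrightarrow>
    (\<exists>S. finite S \<and> S \<subseteq> I \<and> \<not> S \<subseteq> {0} \<and> x \<in> colon R (colon R S))"
proof
  assume "x \<in> top_op R I"
  then obtain S where "finite S" "S \<subseteq> I" "fg_span R S \<noteq> {0}" "x \<in> vop R (fg_span R S)"
    unfolding top_op_def by auto
  then show "\<exists>S. finite S \<and> S \<subseteq> I \<and> \<not> S \<subseteq> {0} \<and> x \<in> colon R (colon R S)"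
    using colon_fg_span[OF subring] fg_span_eq_zero_iff[OF subring]
    by (intro exI[of _ S]) (auto simp: vop_def)
next
  assume "\<exists>S. finite S \<and> S \<subseteq> I \<and> \<not> S \<subseteq> {0} \<and> x \<in> colon R (colon R S)"
  then obtain S where S: "finite S" "S \<subseteq> I" "\<not> S \<subseteq> {0}" "x \<in> colon R (colon R S)"
    by blast
  then have "x \<in> vop R (fg_span R S)" "fg_span R S \<noteq> {0}"
    using colon_fg_span[OF subring] fg_span_eq_zero_iff[OF subring] by (auto simp: vop_def)
  then show "x \<in> top_op R I" unfolding top_op_def using S by blast
qed

lemma subset_top_op:
  assumes "nz_ideal R I"
  shows "I \<subseteq> top_op R I"
proof
  fix x assume x: "x \<in> I"
  obtain d where d: "d \<in> I" "d \<noteq> 0"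
    using assms unfolding nz_ideal_def nonzero_submodule_def submodule_def by blast
  \<comment> \<open>The nonzero \<open>d\<close> keeps the finite set from being contained in
    \<open>{0}\<close> when \<open>x\<close> is zero.\<close>
  show "x \<in> top_op R I"
    unfolding in_top_op_iff
    by (rule exI[of _ "{x, d}"]) (use x d in \<open>auto simp: colon_def mult.commute\<close>)
qed

lemma top_op_subset: "I \<subseteq> R \<Longrightarrow> top_op R I \<subseteq> R"
proof
  fix x assume "I \<subseteq> R" "x \<in> top_op R I"
  then obtain S where "S \<subseteq> R" "x \<in> colon R (colon R S)" unfolding in_top_op_iff by blast
  then have "1 \<in> colon R S" by (auto simp: colon_def)
  with \<open>x \<in> colon R (colon R S)\<close> have "x * 1 \<in> R" unfolding colon_def by blast
  then show "x \<in> R" by simp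
qed

lemma nz_ideal_top_op:
  assumes I: "nz_ideal R I"
  shows "nz_ideal R (top_op R I)"
proof -
  have sub: "I \<subseteq> top_op R I" by (rule subset_top_op[OF I])
  have add: "x + y \<in> top_op R I" if xy: "x \<in> top_op R I" "y \<in> top_op R I" for x y
  proof -
    obtain S T where S: "finite S" "S \<subseteq> I" "\<not> S \<subseteq> {0}" "x \<in> colon R (colon R S)"
      and T: "finite T" "T \<subseteq> I" "\<not> T \<subseteq> {0}" "y \<in> colon R (colon R T)"
      using xy unfolding in_top_op_iff by blast
    have "x + y \<in> colon R (colon R (S \<union> T))"
      using S(4) T(4) by (auto simp: colon_def algebra_simps intro: add_R)
    then show ?thesis unfolding in_top_op_iff using S T by (intro exI[of _ "S \<union> T"]) auto
  qed
  have smult: "r * x \<in> top_op R I" if rx: "r \<in> R" "x \<in> top_op R I" for r x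
  proof -
    obtain S where S: "finite S" "S \<subseteq> I" "\<not> S \<subseteq> {0}" "x \<in> colon R (colon R S)"
      using rx(2) unfolding in_top_op_iff by blast
    have "r * x \<in> colon R (colon R S)"
      using submodule_colon[OF submodule_self] S(4) rx(1) unfolding submodule_def by blast
    then show ?thesis unfolding in_top_op_iff using S by blast
  qed
  have "0 \<in> I" "I \<noteq> {0}" "I \<subseteq> R"
    using I by (auto simp: nz_ideal_def nonzero_submodule_def submodule_def)
  then show ?thesis
    using sub add smult top_op_subset unfolding nz_ideal_def nonzero_submodule_def submodule_def by blast
qed

text \<open>If \<open>(R : S)\<close> is inside \<open>R\<close>, then \<open>1\<close> lies in the
  divisorial closure of \<open>S\<close>, hence in the \<open>t\<close>-closure of
  \<open>N\<close>.\<close>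

lemma proper_t_ideal_not_dense:
  assumes "proper_t_ideal R N"
  shows "\<not> contains_dense R N"
proof
  assume "contains_dense R N"
  then obtain S where S: "finite S" "S \<subseteq> N" "colon R S \<subseteq> R" unfolding contains_dense_def by blast
  \<comment> \<open>Otherwise \<open>(R : S)\<close> would be the whole quotient field, which
    differs from \<open>R\<close>.\<close>
  have "\<not> S \<subseteq> {0}"
  proof
    assume "S \<subseteq> {0}"
    then have "colon R S = UNIV" by (auto simp: colon_def)
    then show False using S(3) not_field by auto
  qed
  moreover have "1 \<in> colon R (colon R S)" using S(3) by (auto simp: colon_def)
  ultimately have "1 \<in> top_op R N" unfolding in_top_op_iff using S by blast
  then have "1 \<in> N" using assms by (simp add: proper_t_ideal_def)
  then have "R \<subseteq> N"
    using assms unfolding proper_t_ideal_def nz_ideal_def nonzero_submodule_def submodule_def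
    by (metis mult.right_neutral subsetI)
  then show False using assms by (auto simp: proper_t_ideal_def nz_ideal_def)
qed

text \<open>Each of the finitely many elements of a dense set lies in the divisorial closure of some
  finite \<open>T s\<close> inside \<open>I\<close>. Every multiplier of the union of these sets
  into \<open>R\<close> is also a multiplier of \<open>S\<close>.\<close>

lemma contains_dense_top_opD:
  assumes "contains_dense R (top_op R I)"
  shows "contains_dense R I"
proof -
  obtain S where S: "finite S" "S \<subseteq> top_op R I" "colon R S \<subseteq> R"
    using assms unfolding contains_dense_def by blast
  have "\<forall>s\<in>S. \<exists>T. finite T \<and> T \<subseteq> I \<and> s \<in> colon R (colon R T)"
    using S(2) unfolding subset_iff in_top_op_iff by blast
  then obtain T where T: "\<And>s. s \<in> S \<Longrightarrow> finite (T s) \<and> T s \<subseteq> I \<and> s \<in> colon R (colon R (T s))"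
    by metis
  have "y \<in> colon R S" if "y \<in> colon R (\<Union>s\<in>S. T s)" for y
    unfolding colon_def
  proof (intro CollectI ballI)
    fix s assume s: "s \<in> S"
    then have "y \<in> colon R (T s)" using that by (auto simp: colon_def)
    moreover have "s \<in> colon R (colon R (T s))" using T[OF s] by blast
    ultimately have "s * y \<in> R" unfolding colon_def by blast
    then show "y * s \<in> R" by (simp add: mult.commute)
  qed
  then have "colon R (\<Union>s\<in>S. T s) \<subseteq> R" using S(3) by blast
  then show ?thesis
    unfolding contains_dense_def by (intro exI[of _ "\<Union>s\<in>S. T s"]) (use S(1) T in auto)
qed

text \<open>Zorn's lemma for the ideals above \<open>I\<close> that contain no dense finite set.
  Density is witnessed by a finite set, so unions of chains stay in this family. The
  \<open>t\<close>-closure of a maximal member \<open>Q\<close> is again in the family, so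
  \<open>Q\<close> is a \<open>t\<close>-ideal.\<close>

lemma exists_tMax:
  assumes I: "nz_ideal R I" "\<not> contains_dense R I"
  shows "\<exists>M\<in>tMax R. I \<subseteq> M"
proof -
  let ?A = "{J. nz_ideal R J \<and> I \<subseteq> J \<and> \<not> contains_dense R J}"
  have "\<exists>Q\<in>?A. \<forall>X\<in>?A. Q \<subseteq> X \<longrightarrow> X = Q"
  proof (rule subset_Zorn_nonempty)
    show "?A \<noteq> {}" using I by auto
    fix C assume C: "C \<noteq> {}" "subset.chain ?A C"
    have CA: "C \<subseteq> ?A" and lin: "\<And>X Y. X \<in> C \<Longrightarrow> Y \<in> C \<Longrightarrow> X \<subseteq> Y \<or> Y \<subseteq> X"
      using C(2) by (auto simp: subset_chain_def)
    have "I \<subseteq> \<Union>C" using C(1) CA by blast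
    moreover have "submodule R (\<Union>C)"
      unfolding submodule_def
    proof (intro conjI ballI)
      show "0 \<in> \<Union>C" using \<open>I \<subseteq> \<Union>C\<close> I by (auto simp: nz_ideal_def nonzero_submodule_def submodule_def)
      fix x assume "x \<in> \<Union>C"
      then obtain X where X: "X \<in> C" "x \<in> X" by blast
      then have sX: "submodule R X" using CA by (auto simp: nz_ideal_def nonzero_submodule_def)
      {
        fix y assume "y \<in> \<Union>C"
        then obtain Y where Y: "Y \<in> C" "y \<in> Y" by blast
        then have sY: "submodule R Y" using CA by (auto simp: nz_ideal_def nonzero_submodule_def)
        show "x + y \<in> \<Union>C" using lin[OF X(1) Y(1)] sX sY X Y unfolding submodule_def by blast
      next
        fix r assume "r \<in> R"
        then show "r * x \<in> \<Union>C" using sX X unfolding submodule_def by blast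
      }
    qed
    moreover have "\<Union>C \<subseteq> R" using CA by (auto simp: nz_ideal_def)
    moreover have "\<Union>C \<noteq> {0}"
      using I \<open>I \<subseteq> \<Union>C\<close> by (auto simp: nz_ideal_def nonzero_submodule_def submodule_def)
    moreover have "\<not> contains_dense R (\<Union>C)"
    proof
      assume "contains_dense R (\<Union>C)"
      then obtain S where S: "finite S" "S \<subseteq> \<Union>C" "colon R S \<subseteq> R" unfolding contains_dense_def by blast
      obtain X where "X \<in> C" "S \<subseteq> X"
        using finite_subset_Union_chain[OF S(1,2) C] by blast
      then show False using S CA unfolding contains_dense_def by blast
    qed
    ultimately show "\<Union>C \<in> ?A" by (auto simp: nz_ideal_def nonzero_submodule_def)
  qed
  then obtain Q where "Q \<in> ?A" and maxA: "\<forall>X\<in>?A. Q \<subseteq> X \<longrightarrow> X = Q" ..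
  then have Q: "nz_ideal R Q" "I \<subseteq> Q" "\<not> contains_dense R Q" by simp_all
  have max: "X = Q" if "nz_ideal R X" "\<not> contains_dense R X" "Q \<subseteq> X" for X
    using maxA that Q(2) by simp
  have "contains_dense R R"
    unfolding contains_dense_def by (rule exI[of _ "{1}"]) (auto simp: colon_def)
  then have "Q \<noteq> R" using Q by auto
  moreover have "top_op R Q = Q"
    using subset_top_op[OF Q(1)] nz_ideal_top_op[OF Q(1)] contains_dense_top_opD Q by (intro max) auto
  ultimately have "proper_t_ideal R Q" using Q by (simp add: proper_t_ideal_def)
  moreover have "N = Q" if "proper_t_ideal R N" "Q \<subseteq> N" for N
    using max[of N] that Q(2) proper_t_ideal_not_dense by (auto simp: proper_t_ideal_def)
  ultimately have "Q \<in> tMax R" by (auto simp: tMax_def)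
  then show ?thesis using Q(2) by blast
qed


lemma tMaxD:
  assumes "M \<in> tMax R"
  shows "nz_ideal R M" "submodule R M" "M \<subseteq> R" "1 \<notin> M" "\<not> contains_dense R M"
proof -
  have t: "proper_t_ideal R M" using assms by (simp add: tMax_def)
  then show M: "nz_ideal R M" "\<not> contains_dense R M"
    using proper_t_ideal_not_dense by (auto simp: proper_t_ideal_def)
  then show "submodule R M" "M \<subseteq> R" by (simp_all add: nz_ideal_def nonzero_submodule_def)
  have "colon R {1} \<subseteq> R" by (auto simp: colon_def)
  then show "1 \<notin> M" using M(2) unfolding contains_dense_def
    by (metis empty_subsetI finite.emptyI finite_insert insert_subset)
qed

lemma tMax_maximal: "M \<in> tMax R \<Longrightarrow> N \<in> tMax R \<Longrightarrow> M \<subseteq> N \<Longrightarrow> N = M"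
  by (simp add: tMax_def)

text \<open>The contrapositive of \<open>exists_tMax\<close>, and the tool for passing from local to
  global statements.\<close>

lemma contains_denseI:
  assumes "submodule R I" "I \<subseteq> R" "I \<noteq> {0}" "\<And>M. M \<in> tMax R \<Longrightarrow> \<exists>s\<in>R - M. s \<in> I"
  shows "contains_dense R I"
proof (rule ccontr)
  assume "\<not> contains_dense R I"
  then obtain M where "M \<in> tMax R" "I \<subseteq> M"
    using exists_tMax[of I] assms(1-3) by (auto simp: nz_ideal_def nonzero_submodule_def)
  then show False using assms(4) by blast
qed

text \<open>If \<open>y\<close> multiplies all products \<open>s * t\<close> into \<open>R\<close>,
  then each \<open>y * s\<close> lies in \<open>(R : T)\<close>, hence in \<open>R\<close>, so
  \<open>y\<close> lies in \<open>(R : S)\<close>.\<close>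

lemma contains_dense_mult:
  assumes "contains_dense R A" "contains_dense R B"
    and "\<And>a b. a \<in> A \<Longrightarrow> b \<in> B \<Longrightarrow> a * b \<in> C"
  shows "contains_dense R C"
proof -
  obtain S T where S: "finite S" "S \<subseteq> A" "colon R S \<subseteq> R" and T: "finite T" "T \<subseteq> B" "colon R T \<subseteq> R"
    using assms(1,2) unfolding contains_dense_def by blast
  let ?U = "(\<lambda>(s, t). s * t) ` (S \<times> T)"
  have "y \<in> R" if y: "y \<in> colon R ?U" for y
  proof -
    have "y * s \<in> colon R T" if "s \<in> S" for s
      using y that by (auto simp: colon_def mult.assoc)
    then have "y \<in> colon R S" using T(3) by (auto simp: colon_def)
    then show ?thesis using S(3) by blast
  qed
  then have "colon R ?U \<subseteq> R" ..
  moreover have "?U \<subseteq> C" using S(2) T(2) assms(3) by auto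
  moreover have "finite ?U" using S(1) T(1) by simp
  ultimately show ?thesis unfolding contains_dense_def by (intro exI[of _ ?U] conjI)
qed

text \<open>For \<open>a\<close> and \<open>b\<close> outside \<open>M\<close>, the ideals
  \<open>M + R a\<close> and \<open>M + R b\<close> lie in no \<open>t\<close>-maximal ideal, so
  both are dense. If \<open>a * b\<close> were in \<open>M\<close>, the product of these ideals
  would lie in \<open>M\<close> and make \<open>M\<close> dense.\<close>

lemma tMax_prime:
  assumes M: "M \<in> tMax R" and ab: "a \<in> R - M" "b \<in> R - M"
  shows "a * b \<in> R - M"
proof (rule ccontr)
  assume "a * b \<notin> R - M"
  then have abM: "a * b \<in> M" using ab mult_R by blast
  note Ms = tMaxD(2)[OF M, unfolded submodule_def]
  let ?I = "\<lambda>c. {m + r * c | m r. m \<in> M \<and> r \<in> R}"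
  have dense: "contains_dense R (?I c)" if c: "c \<in> R - M" for c
  proof (rule contains_denseI)
    have "\<exists>m' r'. x + y = m' + r' * c \<and> m' \<in> M \<and> r' \<in> R" if xy: "x \<in> ?I c" "y \<in> ?I c" for x y
    proof -
      obtain m r m' r' where "x = m + r * c" "y = m' + r' * c" "m \<in> M" "r \<in> R" "m' \<in> M" "r' \<in> R"
        using xy by blast
      then show ?thesis
        by - (rule exI[of _ "m + m'"], rule exI[of _ "r + r'"], auto simp: algebra_simps add_R Ms)
    qed
    moreover have "\<exists>m' r'. q * x = m' + r' * c \<and> m' \<in> M \<and> r' \<in> R" if xq: "x \<in> ?I c" "q \<in> R" for x q
    proof -
      obtain m r where "x = m + r * c" "m \<in> M" "r \<in> R" using xq(1) by blast
      then show ?thesis using xq(2)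
        by - (rule exI[of _ "q * m"], rule exI[of _ "q * r"], simp add: distrib_left mult.assoc mult_R Ms)
    qed
    moreover have "\<exists>m' r'. 0 = m' + r' * c \<and> m' \<in> M \<and> r' \<in> R"
      using Ms zero_R by (metis add_0 mult_zero_left)
    ultimately show "submodule R (?I c)" unfolding submodule_def by blast
    show "?I c \<subseteq> R" using c tMaxD(3)[OF M] by (auto intro!: add_R mult_R)
    have "m + 0 * c \<in> ?I c" if "m \<in> M" for m using that zero_R by blast
    then have MI: "M \<subseteq> ?I c" by auto
    have "0 + 1 * c \<in> ?I c" using Ms one_R by blast
    then have cI: "c \<in> ?I c" by simp
    have "c \<noteq> 0" using c Ms by auto
    then show "?I c \<noteq> {0}" using cI by blast
    fix N assume N: "N \<in> tMax R"
    show "\<exists>s\<in>R - N. s \<in> ?I c"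
    proof (rule ccontr)
      assume "\<not> (\<exists>s\<in>R - N. s \<in> ?I c)"
      then have "?I c \<subseteq> N" using \<open>?I c \<subseteq> R\<close> by blast
      then have "N = M" using MI tMax_maximal[OF M N] by blast
      then show False using \<open>?I c \<subseteq> N\<close> cI c by blast
    qed
  qed
  have "contains_dense R M"
  proof (rule contains_dense_mult[OF dense[OF ab(1)] dense[OF ab(2)]])
    fix x y assume "x \<in> ?I a" "y \<in> ?I b"
    then obtain m r n q where xy: "x = m + r * a" "y = n + q * b" "m \<in> M" "r \<in> R" "n \<in> M" "q \<in> R"
      by blast
    have "x * y = (n + q * b) * m + ((r * a) * n + (r * q) * (a * b))"
      unfolding xy by (simp add: algebra_simps)
    moreover have "n + q * b \<in> R" using xy ab tMaxD(3)[OF M] by (auto intro!: add_R mult_R)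
    moreover have "r * a \<in> R" "r * q \<in> R" using xy ab by (auto intro!: mult_R)
    ultimately show "x * y \<in> M" using Ms abM xy by simp
  qed
  then show False using tMaxD(5)[OF M] by blast
qed

section \<open>Localisation at a \<open>t\<close>-maximal ideal\<close>

lemma denominator_nonzero: "M \<in> tMax R \<Longrightarrow> s \<in> R - M \<Longrightarrow> s \<noteq> 0"
  using tMaxD(2) by (auto simp: submodule_def)

lemma one_denominator: "M \<in> tMax R \<Longrightarrow> 1 \<in> R - M"
  using tMaxD(4) by simp

lemma localizeI: "s \<in> R - M \<Longrightarrow> s * x \<in> E \<Longrightarrow> x \<in> localize R M E"
  unfolding localize_def by blast

lemma subset_localize: "M \<in> tMax R \<Longrightarrow> E \<subseteq> localize R M E"
proof
  fix x assume "M \<in> tMax R" "x \<in> E"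
  then show "x \<in> localize R M E" using one_denominator by (intro localizeI[of 1]) auto
qed

lemma localize_localize:
  assumes "M \<in> tMax R" "s \<in> R - M" "s * x \<in> localize R M E"
  shows "x \<in> localize R M E"
proof -
  obtain t where "t \<in> R - M" "t * (s * x) \<in> E" using assms(3) unfolding localize_def by blast
  then show ?thesis
    using tMax_prime[OF assms(1) _ assms(2)] by (intro localizeI[of "t * s"]) (auto simp: mult.assoc)
qed

lemma submodule_localize:
  assumes M: "M \<in> tMax R" and E: "submodule R E"
  shows "submodule R (localize R M E)"
proof -
  have "x + y \<in> localize R M E" if xy: "x \<in> localize R M E" "y \<in> localize R M E" for x y
  proof -
    obtain s t where st: "s \<in> R - M" "s * x \<in> E" "t \<in> R - M" "t * y \<in> E"
      using xy unfolding localize_def by blast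
    then have "t * (s * x) + s * (t * y) \<in> E" using E by (auto simp: submodule_def)
    then have "(s * t) * (x + y) \<in> E" by (simp add: algebra_simps)
    then show ?thesis using tMax_prime[OF M st(1,3)] by (rule localizeI[rotated])
  qed
  moreover have "r * x \<in> localize R M E" if rx: "r \<in> R" "x \<in> localize R M E" for r x
  proof -
    obtain s where s: "s \<in> R - M" "s * x \<in> E" using rx(2) unfolding localize_def by blast
    then have "r * (s * x) \<in> E" using E rx(1) by (auto simp: submodule_def)
    then show ?thesis using s by (intro localizeI[of s]) (auto simp: algebra_simps)
  qed
  moreover have "0 \<in> localize R M E"
    using subset_localize[OF M] E by (auto simp: submodule_def)
  ultimately show ?thesis by (auto simp: submodule_def)
qed

lemma common_denominator:
  assumes M: "M \<in> tMax R" and E: "submodule R E" and F: "finite F" "F \<subseteq> localize R M E"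
  shows "\<exists>s\<in>R - M. \<forall>f\<in>F. s * f \<in> E"
  using F
proof (induction F rule: finite_induct)
  case empty
  then show ?case using one_denominator[OF M] by blast
next
  case (insert f F)
  then obtain s where s: "s \<in> R - M" "\<forall>f\<in>F. s * f \<in> E" by auto
  obtain t where t: "t \<in> R - M" "t * f \<in> E" using insert.prems unfolding localize_def by blast
  have "s * (t * f) \<in> E" "\<forall>f\<in>F. t * (s * f) \<in> E" using s t E by (auto simp: submodule_def)
  then show ?case using tMax_prime[OF M s(1) t(1)]
    by (intro bexI[of _ "s * t"]) (auto simp: mult_ac)
qed

lemma loc_eq_localize:
  assumes "M \<in> tMax R"
  shows "loc R M = localize R M R"
proof (intro set_eqI iffI)
  fix x assume "x \<in> loc R M"
  then obtain a s where "a \<in> R" "s \<in> R - M" "x = a / s" by (auto simp: loc_def)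
  then show "x \<in> localize R M R"
    using denominator_nonzero[OF assms] by (intro localizeI[of s]) auto
next
  fix x assume "x \<in> localize R M R"
  then obtain s where s: "s \<in> R - M" "s * x \<in> R" unfolding localize_def by blast
  then have "x = (s * x) / s" using denominator_nonzero[OF assms s(1)] by simp
  then show "x \<in> loc R M" unfolding loc_def using s by blast
qed

lemma mprod_loc:
  assumes M: "M \<in> tMax R" and E: "submodule R E"
  shows "mprod E (loc R M) = localize R M E"
proof
  show "mprod E (loc R M) \<subseteq> localize R M E"
  proof (rule mprod_subset[OF submodule_localize[OF M E]])
    fix a b assume a: "a \<in> E" and "b \<in> loc R M"
    then obtain s where s: "s \<in> R - M" "s * b \<in> R"
      unfolding loc_eq_localize[OF M] localize_def by blast
    then have "(s * b) * a \<in> E" using a E by (simp add: submodule_def)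
    then show "a * b \<in> localize R M E" using s by (intro localizeI[of s]) (auto simp: mult_ac)
  qed
  show "localize R M E \<subseteq> mprod E (loc R M)"
  proof
    fix x assume "x \<in> localize R M E"
    then obtain s where s: "s \<in> R - M" "s * x \<in> E" unfolding localize_def by blast
    have "(s * x) * (1 / s) \<in> mprod E (loc R M)"
      using s by (intro mprodI) (auto simp: loc_def)
    then show "x \<in> mprod E (loc R M)" using denominator_nonzero[OF M s(1)] by simp
  qed
qed

section \<open>The \<open>w\<close>-closure and a local criterion for
  \<open>w\<close>-stability\<close>

lemma wop_eq: "submodule R E \<Longrightarrow> wop R E = (\<Inter>M\<in>tMax R. localize R M E)"
  by (simp add: wop_def mprod_loc)

lemma subset_wop: "submodule R E \<Longrightarrow> E \<subseteq> wop R E"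
  using subset_localize by (fastforce simp: wop_eq)

lemma submodule_wop:
  assumes "submodule R E"
  shows "submodule R (wop R E)"
proof -
  have "submodule R (localize R M E)" if "M \<in> tMax R" for M
    using submodule_localize[OF that assms] .
  then show ?thesis unfolding wop_eq[OF assms] by (simp add: submodule_def)
qed

lemma wop_mono: "submodule R A \<Longrightarrow> submodule R B \<Longrightarrow> A \<subseteq> B \<Longrightarrow> wop R A \<subseteq> wop R B"
  unfolding wop_eq localize_def by blast

lemma wop_wop:
  assumes "submodule R E"
  shows "wop R (wop R E) = wop R E"
proof
  show "wop R (wop R E) \<subseteq> wop R E"
  proof
    fix x assume x: "x \<in> wop R (wop R E)"
    have "x \<in> localize R M E" if M: "M \<in> tMax R" for M
    proof -
      have "x \<in> localize R M (wop R E)" using x M by (simp add: wop_eq[OF submodule_wop[OF assms]])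
      then obtain s where "s \<in> R - M" "s * x \<in> wop R E" unfolding localize_def by blast
      then show ?thesis using localize_localize[OF M] M by (auto simp: wop_eq[OF assms])
    qed
    then show "x \<in> wop R E" by (simp add: wop_eq assms)
  qed
qed (simp add: subset_wop submodule_wop assms)

text \<open>The denominators of an element \<open>x\<close> of the closure form an ideal that lies
  in no \<open>t\<close>-maximal ideal. It therefore contains a finite \<open>S\<close> with
  \<open>(R : S)\<close> inside \<open>R\<close>, and \<open>x\<close> belongs to
  \<open>(R : S)\<close>.\<close>

lemma wop_self: "wop R R = R"
proof
  show "wop R R \<subseteq> R"
  proof
    fix x assume x: "x \<in> wop R R"
    let ?I = "R \<inter> colon R {x}"
    have "contains_dense R ?I"
    proof (rule contains_denseI)
      show "submodule R ?I"
        using submodule_self submodule_colon[OF submodule_self, of "{x}"] by (auto simp: submodule_def)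
      obtain a b where "a \<in> R" "b \<in> R" "b \<noteq> 0" "x = a / b"
        using quotient_field by (meson is_quotient_field_def)
      then have "b \<in> ?I" by (auto simp: colon_def)
      with \<open>b \<noteq> 0\<close> show "?I \<noteq> {0}" by blast
      show "\<exists>s\<in>R - M. s \<in> ?I" if "M \<in> tMax R" for M
        using x that by (auto simp: wop_eq[OF submodule_self] localize_def colon_def)
    qed simp
    then obtain S where "S \<subseteq> colon R {x}" "colon R S \<subseteq> R" unfolding contains_dense_def by blast
    then have "x \<in> colon R S" by (auto simp: colon_def mult.commute)
    then show "x \<in> R" using \<open>colon R S \<subseteq> R\<close> by blast
  qed
qed (rule subset_wop[OF submodule_self])

lemma w_idealD:
  assumes "w_ideal R I"
  shows "submodule R I" "I \<subseteq> R" "wop R I = I" "\<exists>d\<in>I. d \<noteq> 0"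
  using assms by (auto simp: w_ideal_def nz_ideal_def nonzero_submodule_def submodule_def)

lemma w_idealI:
  assumes "submodule R I" "I \<subseteq> R" "d \<in> I" "d \<noteq> 0" "wop R I \<subseteq> I"
  shows "w_ideal R I"
  using assms subset_wop[of I] by (auto simp: w_ideal_def nz_ideal_def nonzero_submodule_def)

text \<open>The inverse of \<open>I\<close> over its endomorphism ring is \<open>(I : I I)\<close>;
  in this form membership can be checked inside \<open>I\<close>.\<close>

lemma colon_Eend: "x \<in> colon (Eend I) I \<longleftrightarrow> (\<forall>a\<in>I. \<forall>b\<in>I. x * a * b \<in> I)"
  by (auto simp: colon_def Eend_def)

lemma Eend_mult: "x \<in> Eend I \<Longrightarrow> a \<in> I \<Longrightarrow> x * a \<in> I"
  by (auto simp: colon_def Eend_def)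

lemma submodule_Eend: "submodule R I \<Longrightarrow> submodule R (Eend I)"
  by (simp add: Eend_def submodule_colon)

lemma wop_Eend:
  assumes "w_ideal R I"
  shows "wop R (Eend I) = Eend I"
proof
  note I = w_idealD[OF assms]
  show "wop R (Eend I) \<subseteq> Eend I"
  proof
    fix x assume x: "x \<in> wop R (Eend I)"
    have "x * a \<in> wop R I" if "a \<in> I" for a
      unfolding wop_eq[OF I(1)]
    proof
      fix M assume M: "M \<in> tMax R"
      then obtain s where "s \<in> R - M" "s * x \<in> Eend I"
        using x by (auto simp: wop_eq[OF submodule_Eend[OF I(1)]] localize_def)
      then show "x * a \<in> localize R M I"
        using Eend_mult[of "s * x" I a] that by (intro localizeI[of s]) (auto simp: mult.assoc)
    qed
    then show "x \<in> Eend I" using I(3) by (auto simp: Eend_def colon_def)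
  qed
qed (simp add: subset_wop submodule_Eend w_idealD[OF assms])

lemma mprod_colon_subset: "submodule R I \<Longrightarrow> mprod I (colon (Eend I) I) \<subseteq> Eend I"
  by (rule mprod_subset[OF submodule_Eend]) (auto simp: colon_def mult.commute)

lemma mprod_colon_Eend:
  assumes "e \<in> Eend I" "x \<in> mprod I (colon (Eend I) I)"
  shows "e * x \<in> mprod I (colon (Eend I) I)"
  using assms by (auto intro: mprod_scale Eend_mult)

text \<open>The product \<open>I (E(I) : I)\<close> is an ideal of \<open>E(I)\<close>, so its
  \<open>w\<close>-closure is \<open>E(I)\<close> as soon as it contains \<open>1\<close>. Locally
  this asks for an element of the product outside \<open>M\<close>.\<close>

lemma w_stable_ideal_iff:
  assumes "w_ideal R I"
  shows "w_stable_ideal R I \<longleftrightarrow>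
    (\<forall>M\<in>tMax R. \<exists>s\<in>R - M. s \<in> mprod I (colon (Eend I) I))" (is "_ \<longleftrightarrow> ?P")
proof
  note I = w_idealD[OF assms]
  let ?J = "mprod I (colon (Eend I) I)"
  have J: "submodule R ?J" using I(1) by (rule submodule_mprod)
  {
    assume "w_stable_ideal R I"
    then have "1 \<in> wop R ?J" by (simp add: w_stable_ideal_def Eend_def colon_def)
    then show ?P by (simp add: wop_eq[OF J] localize_def)
  next
    assume P: ?P
    have "e \<in> localize R M ?J" if eM: "e \<in> Eend I" "M \<in> tMax R" for e M
    proof -
      obtain s where "s \<in> R - M" "s \<in> ?J" using P eM(2) by blast
      then show ?thesis using mprod_colon_Eend[OF eM(1), of s] by (intro localizeI[of s]) (auto simp: mult.commute)
    qed
    then have "Eend I \<subseteq> wop R ?J" by (auto simp: wop_eq[OF J])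
    moreover have "wop R ?J \<subseteq> Eend I"
      using wop_mono[OF J submodule_Eend[OF I(1)] mprod_colon_subset[OF I(1)]] wop_Eend[OF assms] by simp
    ultimately show "w_stable_ideal R I" by (simp add: w_stable_ideal_def)
  }
qed

lemma localize_mono: "A \<subseteq> B \<Longrightarrow> localize R M A \<subseteq> localize R M B"
  unfolding localize_def by blast

lemma localize_mult:
  assumes M: "M \<in> tMax R" and E: "submodule R E"
    and a: "a \<in> localize R M R" and x: "x \<in> localize R M E"
  shows "a * x \<in> localize R M E"
proof -
  obtain s where s: "s \<in> R - M" "s * a \<in> R" using a unfolding localize_def by blast
  have "(s * a) * x \<in> localize R M E"
    using submodule_localize[OF M E] s(2) x unfolding submodule_def by blast
  then show ?thesis using localize_localize[OF M s(1)] by (simp add: mult.assoc)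
qed

lemma tMax_w_ideal:
  assumes M: "M \<in> tMax R"
  shows "w_ideal R M"
proof -
  obtain d where d: "d \<in> M" "d \<noteq> 0"
    using tMaxD(1)[OF M] unfolding nz_ideal_def nonzero_submodule_def submodule_def by blast
  show ?thesis
  proof (rule w_idealI[OF tMaxD(2,3)[OF M] d])
    show "wop R M \<subseteq> M"
    proof
      fix x assume x: "x \<in> wop R M"
      then have xR: "x \<in> R"
        using wop_mono[OF tMaxD(2)[OF M] submodule_self tMaxD(3)[OF M]] wop_self by blast
      obtain s where "s \<in> R - M" "s * x \<in> M"
        using x M unfolding wop_eq[OF tMaxD(2)[OF M]] localize_def by blast
      then show "x \<in> M" using tMax_prime[OF M, of s x] xR by blast
    qed
  qed
qed

section \<open>Stability and divisoriality over the endomorphism ring\<close>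

text \<open>An element \<open>x\<close> of the double dual multiplies \<open>I (E(I) : I)\<close>
  into \<open>I\<close>. This product contains some \<open>s\<close> outside any given
  \<open>M\<close>, so \<open>s * x\<close> is in \<open>I\<close> and \<open>x\<close> is locally
  in \<open>I\<close>.\<close>

theorem w_stable_imp_divisorial:
  assumes "w_stable R" and wI: "w_ideal R I"
  shows "colon (Eend I) (colon (Eend I) I) = I"
proof
  note I = w_idealD[OF wI]
  let ?K = "colon (Eend I) I"
  show "I \<subseteq> colon (Eend I) ?K" by (auto simp: colon_def mult.commute)
  show "colon (Eend I) ?K \<subseteq> I"
  proof
    fix x assume x: "x \<in> colon (Eend I) ?K"
    have "x \<in> wop R I"
      unfolding wop_eq[OF I(1)]
    proof
      fix M assume M: "M \<in> tMax R"
      obtain s where s: "s \<in> R - M" "s \<in> mprod I ?K"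
        using assms M w_stable_ideal_iff[OF wI] unfolding w_stable_def by blast
      from s(2) have "x * s \<in> I"
      proof (induction rule: mprod_induct)
        case zero
        then show ?case using I(1) by (simp add: submodule_def)
      next
        case (add a b y)
        then have "x * b \<in> Eend I" using x by (auto simp: colon_def)
        then have "x * b * a \<in> I" using add(1) by (rule Eend_mult)
        then have "x * y + x * b * a \<in> I" using add I(1) unfolding submodule_def by blast
        then show ?case by (simp add: algebra_simps)
      qed
      then show "x \<in> localize R M I" using s(1) by (intro localizeI[of s]) (simp_all add: mult.commute)
    qed
    then show "x \<in> I" using I(3) by simp
  qed
qed

text \<open>Let \<open>W\<close> be the \<open>w\<close>-closure of \<open>J = I (E : I)\<close>. A
  scaled copy \<open>L = d W\<close> is a \<open>w\<close>-ideal with endomorphism ring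
  \<open>E\<close>. Since \<open>(E : J) = E\<close>, the double dual of \<open>L\<close> contains
  \<open>d\<close>, and divisoriality of \<open>L\<close> gives \<open>1 \<in> W\<close>.\<close>

theorem divisorial_imp_w_stable:
  assumes div: "\<And>I. w_ideal R I \<Longrightarrow> colon (Eend I) (colon (Eend I) I) = I"
  shows "w_stable R"
  unfolding w_stable_def
proof (intro allI impI)
  fix I assume wI: "w_ideal R I"
  note I = w_idealD[OF wI]
  define E where "E = Eend I"
  define J where "J = mprod I (colon E I)"
  define W where "W = wop R J"
  obtain d where d: "d \<in> I" "d \<noteq> 0" using I(4) by blast
  have E: "submodule R E" "wop R E = E"
    using submodule_Eend[OF I(1)] wop_Eend[OF wI] by (simp_all add: E_def)
  have J: "submodule R J" "J \<subseteq> E"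
    using submodule_mprod[OF I(1)] mprod_colon_subset[OF I(1)] by (simp_all add: J_def E_def)
  have W: "submodule R W" "J \<subseteq> W" "wop R W = W" "W \<subseteq> E"
    using submodule_wop[OF J(1)] subset_wop[OF J(1)] wop_wop[OF J(1)] wop_mono[OF J(1) E(1) J(2)] E(2)
    by (simp_all add: W_def)
  \<comment> \<open>Divisoriality of \<open>I\<close> makes the inverse of \<open>I (E : I)\<close> in \<open>E\<close> trivial.\<close>
  have key: "y \<in> E" if y: "\<And>j. j \<in> J \<Longrightarrow> y * j \<in> E" for y
  proof -
    have "y * a \<in> colon E (colon E I)" if a: "a \<in> I" for a
      unfolding colon_def[of E "colon E I"]
    proof (intro CollectI ballI)
      fix c assume "c \<in> colon E I"
      then have "y * (a * c) \<in> E" using a by (intro y) (simp add: J_def mprodI)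
      then show "y * a * c \<in> E" by (simp add: mult.assoc)
    qed
    then show ?thesis using div[OF wI] by (auto simp: E_def Eend_def colon_def)
  qed
  \<comment> \<open>\<open>W\<close> lies in \<open>E\<close> but possibly not in \<open>R\<close>.
    As \<open>d\<close> is in \<open>I\<close>, the multiple \<open>d W\<close> lies in
    \<open>I\<close> and hence in \<open>R\<close>.\<close>
  define L where "L = (\<lambda>y. d * y) ` W"
  have L: "submodule R L"
    unfolding submodule_def
  proof (intro conjI ballI)
    show "0 \<in> L" using W(1) by (force simp: L_def submodule_def)
    fix u assume "u \<in> L"
    then obtain u' where u: "u = d * u'" "u' \<in> W" by (auto simp: L_def)
    {
      fix v assume "v \<in> L"
      then obtain v' where v: "v = d * v'" "v' \<in> W" by (auto simp: L_def)
      have "u' + v' \<in> W" using u v W(1) by (simp add: submodule_def)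
      then have "d * (u' + v') \<in> L" unfolding L_def by (rule imageI)
      then show "u + v \<in> L" by (simp add: u v algebra_simps)
    next
      fix r assume "r \<in> R"
      then have "r * u' \<in> W" using u W(1) by (simp add: submodule_def)
      then have "d * (r * u') \<in> L" unfolding L_def by (rule imageI)
      then show "r * u \<in> L" by (simp add: u mult.left_commute)
    }
  qed
  have L_iff: "d * y \<in> L \<longleftrightarrow> y \<in> W" for y using d(2) by (auto simp: L_def)
  have wL: "w_ideal R L"
  proof (rule w_idealI[OF L])
    show "L \<subseteq> R"
    proof
      fix u assume "u \<in> L"
      then obtain y where "u = d * y" "y \<in> E" using W(4) by (auto simp: L_def)
      then have "u \<in> I" using Eend_mult[of y I d] d by (simp add: E_def mult.commute)
      then show "u \<in> R" using I(2) by blast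
    qed
    \<comment> \<open>Products of elements of the ideal \<open>I\<close> stay in \<open>I\<close>,
      so \<open>1\<close> is in \<open>(E : I)\<close> and \<open>d\<close> is in \<open>J\<close>.
      This makes \<open>d * d\<close> a nonzero element of \<open>L\<close>.\<close>
    have "1 \<in> colon E I"
      using I(1,2) unfolding E_def colon_Eend submodule_def by auto
    then have "d * 1 \<in> J" unfolding J_def using d by (intro mprodI)
    then show "d * d \<in> L" using W(2) by (auto simp: L_iff)
    show "d * d \<noteq> 0" using d by simp
    show "wop R L \<subseteq> L"
    proof
      fix u assume u: "u \<in> wop R L"
      have "u / d \<in> wop R W"
        unfolding wop_eq[OF W(1)]
      proof
        fix M assume M: "M \<in> tMax R"
        then obtain s where s: "s \<in> R - M" "s * u \<in> L"
          using u unfolding wop_eq[OF L] localize_def by blast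
        have "d * (s * (u / d)) = s * u" using d(2) by simp
        then have "s * (u / d) \<in> W" using s(2) L_iff by metis
        then show "u / d \<in> localize R M W" using s(1) by (rule localizeI[rotated])
      qed
      then have "d * (u / d) \<in> L" unfolding L_iff W(3) .
      then show "u \<in> L" using d(2) by simp
    qed
  qed
  have EW: "e * y \<in> W" if e: "e \<in> E" and y: "y \<in> W" for e y
    unfolding W_def wop_eq[OF J(1)]
  proof
    fix M assume M: "M \<in> tMax R"
    then obtain s where s: "s \<in> R - M" "s * y \<in> J"
      using y unfolding W_def wop_eq[OF J(1)] localize_def by blast
    then have "e * (s * y) \<in> J"
      using e mprod_colon_Eend unfolding J_def E_def by blast
    then show "e * y \<in> localize R M J"
      using s(1) by (intro localizeI[of s]) (simp_all add: mult.left_commute)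
  qed
  \<comment> \<open>An endomorphism of \<open>L\<close> sends \<open>J\<close> into
    \<open>W\<close>, which lies in \<open>E\<close>, so \<open>key\<close> puts it in
    \<open>E\<close>; the converse is that \<open>W\<close> is an \<open>E\<close>-module.\<close>
  have "Eend L = E"
  proof (intro set_eqI iffI)
    fix e assume e: "e \<in> Eend L"
    have "e * j \<in> E" if "j \<in> J" for j
    proof -
      have "d * j \<in> L" using that W(2) L_iff by blast
      then have "e * (d * j) \<in> L" by (rule Eend_mult[OF e])
      then have "d * (e * j) \<in> L" by (simp add: mult.left_commute)
      then show ?thesis using L_iff W(4) by blast
    qed
    then show "e \<in> E" by (rule key)
  next
    fix e assume e: "e \<in> E"
    show "e \<in> Eend L"
      using EW[OF e] L_iff by (auto simp: Eend_def colon_def L_def mult.left_commute)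
  qed
  then have divL: "colon E (colon E L) = L" using div[OF wL] by simp
  have "d \<in> colon E (colon E L)"
    unfolding colon_def[of E "colon E L"]
  proof (intro CollectI ballI)
    fix c assume c: "c \<in> colon E L"
    show "d * c \<in> E"
    proof (rule key)
      fix j assume "j \<in> J"
      then have "d * j \<in> L" using W(2) L_iff by blast
      then have "c * (d * j) \<in> E" using c by (simp add: colon_def)
      then show "d * c * j \<in> E" by (simp add: mult_ac)
    qed
  qed
  then have "d * 1 \<in> L" using divL by simp
  then have "1 \<in> W" unfolding L_iff .
  then have "E \<subseteq> W" using EW[of _ 1] by auto
  then show "w_stable_ideal R I"
    using W(4) by (auto simp: w_stable_ideal_def W_def J_def E_def)
qed

section \<open>Stability of the localisations\<close>

text \<open>An ideal \<open>J\<close> of the localisation contracts to a \<open>w\<close>-ideal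
  \<open>I\<close> of \<open>R\<close> from which \<open>J\<close> is recovered by denominators.
  Stability of \<open>I\<close> puts an element outside \<open>M\<close> into
  \<open>J (E(J) : J)\<close>, and such an element is a unit of the localisation.\<close>

theorem w_stable_imp_stable_loc:
  assumes stable: "w_stable R" and M: "M \<in> tMax R"
  shows "stable_domain (loc R M)"
  unfolding stable_domain_def
proof (intro allI impI)
  fix J assume nzJ: "nz_ideal (loc R M) J"
  have J: "0 \<in> J" "\<And>x y. x \<in> J \<Longrightarrow> y \<in> J \<Longrightarrow> x + y \<in> J" "J \<subseteq> localize R M R"
    "\<And>r x. r \<in> localize R M R \<Longrightarrow> x \<in> J \<Longrightarrow> r * x \<in> J" "\<exists>d\<in>J. d \<noteq> 0"
    using nzJ unfolding nz_ideal_def nonzero_submodule_def submodule_def loc_eq_localize[OF M] by auto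
  have RD: "R \<subseteq> localize R M R" by (rule subset_localize[OF M])
  have inv: "1 / s \<in> localize R M R" if "s \<in> R - M" for s
    using that denominator_nonzero[OF M that] by (intro localizeI[of s]) simp_all
  have cancel: "x \<in> J" if s: "s \<in> R - M" "s * x \<in> J" for s x
    using J(4)[OF inv[OF s(1)] s(2)] denominator_nonzero[OF M s(1)] by simp
  have sJ: "submodule R J" using J(1,2,4) RD unfolding submodule_def by blast
  define I where "I = J \<inter> R"
  have sI: "submodule R I" using sJ submodule_self by (simp add: I_def submodule_def)
  have clear: "\<exists>s\<in>R - M. s * x \<in> I" if x: "x \<in> J" for x
  proof -
    obtain s where s: "s \<in> R - M" "s * x \<in> R" using x J(3) unfolding localize_def by blast
    moreover have "s * x \<in> J" using x s sJ by (simp add: submodule_def)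
    ultimately show ?thesis by (auto simp: I_def)
  qed
  obtain d where d: "d \<in> J" "d \<noteq> 0" using J(5) by blast
  obtain t where t: "t \<in> R - M" "t * d \<in> I" using clear[OF d(1)] by blast
  have wI: "w_ideal R I"
  proof (rule w_idealI[OF sI])
    show "I \<subseteq> R" by (simp add: I_def)
    show "t * d \<in> I" "t * d \<noteq> 0" using t d denominator_nonzero[OF M t(1)] by auto
    show "wop R I \<subseteq> I"
    proof
      fix x assume x: "x \<in> wop R I"
      then have "x \<in> R" using wop_mono[OF sI submodule_self] wop_self by (auto simp: I_def)
      moreover obtain s where "s \<in> R - M" "s * x \<in> I"
        using x M unfolding wop_eq[OF sI] localize_def by blast
      ultimately show "x \<in> I" using cancel[of s x] by (simp add: I_def)
    qed
  qed
  \<comment> \<open>Denominators of \<open>u\<close> and \<open>v\<close> move both into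
    \<open>I\<close>; their product is then cancelled in \<open>J\<close>.\<close>
  have K: "colon (Eend I) I \<subseteq> colon (Eend J) J"
  proof
    fix c assume c: "c \<in> colon (Eend I) I"
    show "c \<in> colon (Eend J) J"
      unfolding colon_Eend
    proof (intro ballI)
      fix u v assume "u \<in> J" "v \<in> J"
      then obtain s t where st: "s \<in> R - M" "s * u \<in> I" "t \<in> R - M" "t * v \<in> I"
        using clear by blast
      then have "c * (s * u) * (t * v) \<in> I" using c unfolding colon_Eend by blast
      then have "(s * t) * (c * u * v) \<in> J" by (simp add: I_def mult_ac)
      then show "c * u * v \<in> J" by (rule cancel[OF tMax_prime[OF M st(1,3)]])
    qed
  qed
  obtain s where s: "s \<in> R - M" "s \<in> mprod I (colon (Eend I) I)"
    using stable wI M w_stable_ideal_iff[OF wI] unfolding w_stable_def by blast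
  then have "s \<in> mprod J (colon (Eend J) J)" using mprod_mono[OF _ K, of I J] by (auto simp: I_def)
  then have "1 / s * s \<in> mprod J (colon (Eend J) J)" by (rule mprod_scale) (rule J(4)[OF inv[OF s(1)]])
  then have one: "1 \<in> mprod J (colon (Eend J) J)" using denominator_nonzero[OF M s(1)] by simp
  have "e \<in> mprod J (colon (Eend J) J)" if "e \<in> Eend J" for e
    using mprod_colon_Eend[OF that one] by simp
  then show "mprod J (colon (Eend J) J) = Eend J" using mprod_colon_subset[OF sJ] by blast
qed

section \<open>The hull \<open>R + (N : N N)\<close> of a \<open>t\<close>-maximal ideal\<close>

text \<open>Note that \<open>(E(N) : N) = (N : N\<^sup>2)\<close>.\<close>

definition inverse_hull :: "'a set \<Rightarrow> 'a set" where
  "inverse_hull N = {r + c | r c. r \<in> R \<and> c \<in> colon (Eend N) N}"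

context
  fixes N assumes N: "N \<in> tMax R"
begin

lemma submodule_inverse_hull: "submodule R (inverse_hull N)"
proof -
  have K: "submodule R (colon (Eend N) N)"
    by (intro submodule_colon submodule_Eend tMaxD(2)[OF N])
  show ?thesis
    unfolding submodule_def
  proof (intro conjI ballI)
    have "0 + 0 \<in> inverse_hull N" using K zero_R unfolding inverse_hull_def submodule_def by blast
    then show "0 \<in> inverse_hull N" by simp
    fix u assume "u \<in> inverse_hull N"
    then obtain r c where u: "u = r + c" "r \<in> R" "c \<in> colon (Eend N) N"
      unfolding inverse_hull_def by blast
    {
      fix v assume "v \<in> inverse_hull N"
      then obtain r' c' where v: "v = r' + c'" "r' \<in> R" "c' \<in> colon (Eend N) N"
        unfolding inverse_hull_def by blast
      have "(r + r') + (c + c') \<in> inverse_hull N"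
        using u v K add_R unfolding inverse_hull_def submodule_def by blast
      then show "u + v \<in> inverse_hull N" by (simp add: u v algebra_simps)
    next
      fix q assume "q \<in> R"
      then have "q * r + q * c \<in> inverse_hull N"
        using u K mult_R unfolding inverse_hull_def submodule_def by blast
      then show "q * u \<in> inverse_hull N" by (simp add: u algebra_simps)
    }
  qed
qed

lemma subset_inverse_hull: "R \<subseteq> inverse_hull N" "colon (Eend N) N \<subseteq> inverse_hull N"
proof -
  have K: "0 \<in> colon (Eend N) N"
    using submodule_colon[OF submodule_Eend[OF tMaxD(2)[OF N]]] unfolding submodule_def by blast
  show "R \<subseteq> inverse_hull N"
  proof
    fix r assume "r \<in> R"
    then have "r + 0 \<in> inverse_hull N" using K unfolding inverse_hull_def by blast
    then show "r \<in> inverse_hull N" by simp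
  qed
  show "colon (Eend N) N \<subseteq> inverse_hull N"
  proof
    fix c assume "c \<in> colon (Eend N) N"
    then have "0 + c \<in> inverse_hull N" using zero_R unfolding inverse_hull_def by blast
    then show "c \<in> inverse_hull N" by simp
  qed
qed

lemma inverse_hull_mult:
  assumes "b \<in> inverse_hull N" "m \<in> N" "n \<in> N"
  shows "m * n * b \<in> N"
proof -
  obtain r c where b: "b = r + c" "r \<in> R" "c \<in> colon (Eend N) N"
    using assms(1) unfolding inverse_hull_def by blast
  have "c * m * n \<in> N" using b(3) assms(2,3) unfolding colon_Eend by blast
  moreover have "(r * m) * n \<in> N"
    using b(2) assms(2,3) tMaxD(2,3)[OF N] unfolding submodule_def by blast
  ultimately have "r * m * n + c * m * n \<in> N" using tMaxD(2)[OF N] unfolding submodule_def by blast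
  then show ?thesis by (simp add: b algebra_simps)
qed

text \<open>The square of any element of \<open>N\<close> outside \<open>M\<close> is a denominator,
  because \<open>N N\<close> multiplies the hull into \<open>N\<close>.\<close>

lemma inverse_hull_localize:
  assumes "b \<in> inverse_hull N" "M \<in> tMax R" "M \<noteq> N"
  shows "b \<in> localize R M R"
proof -
  obtain n where n: "n \<in> N" "n \<notin> M" using tMax_maximal[OF N assms(2)] assms(3) by blast
  then have nM: "n \<in> R - M" using tMaxD(3)[OF N] by blast
  have "n * n * b \<in> R" using inverse_hull_mult[OF assms(1) n(1) n(1)] tMaxD(3)[OF N] by blast
  then show ?thesis by (rule localizeI[OF tMax_prime[OF assms(2) nM nM]])
qed

text \<open>If the localised hull \<open>B\<close> were closed under multiplication, then \<open>1 \<in> N B\<close> would give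
  \<open>1 \<in> N\<^sup>2 B \<subseteq> N R\<^sub>N\<close>.\<close>

lemma inverse_hull_not_ring:
  assumes stable: "w_stable R"
  shows "\<exists>b\<in>inverse_hull N. \<exists>c\<in>inverse_hull N. b * c \<notin> localize R N (inverse_hull N)"
proof (rule ccontr)
  assume "\<not> ?thesis"
  then have ring: "\<And>b c. b \<in> inverse_hull N \<Longrightarrow> c \<in> inverse_hull N \<Longrightarrow> b * c \<in> localize R N (inverse_hull N)"
    by blast
  let ?K = "colon (Eend N) N"
  have loc: "submodule R (localize R N N)" by (rule submodule_localize[OF N tMaxD(2)[OF N]])
  have prod: "(m * k) * (n * l) \<in> localize R N N" if mn: "m \<in> N" "n \<in> N" and kl: "k \<in> ?K" "l \<in> ?K" for m n k l
  proof -
    have "k * l \<in> localize R N (inverse_hull N)" using kl subset_inverse_hull(2) by (intro ring) auto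
    then obtain s where s: "s \<in> R - N" "s * (k * l) \<in> inverse_hull N" unfolding localize_def by blast
    have "m * n * (s * (k * l)) \<in> N" by (rule inverse_hull_mult[OF s(2) mn])
    then show ?thesis using s(1) by (intro localizeI[of s]) (simp_all add: mult_ac)
  qed
  have half: "(m * k) * y \<in> localize R N N" if mk: "m \<in> N" "k \<in> ?K" and y: "y \<in> mprod N ?K" for m k y
    using y
  proof (induction rule: mprod_induct)
    case zero
    then show ?case using loc by (simp add: submodule_def)
  next
    case (add n l y)
    then have "(m * k) * y + (m * k) * (n * l) \<in> localize R N N"
      using loc prod[OF mk(1) add(1) mk(2) add(2)] unfolding submodule_def by blast
    then show ?case by (simp add: distrib_left)
  qed
  obtain s where s: "s \<in> R - N" "s \<in> mprod N ?K"
    using stable w_stable_ideal_iff[OF tMax_w_ideal[OF N]] tMax_w_ideal[OF N] N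
    unfolding w_stable_def by blast
  \<comment> \<open>The induction expands only the first factor as a sum of products
    \<open>m * k\<close>; the second stays fixed because \<open>half\<close> has already expanded
    it.\<close>
  from s(2) have "s * s \<in> localize R N N"
  proof (induction rule: mprod_induct[where P = "\<lambda>y. y * s \<in> localize R N N"])
    case zero
    then show ?case using loc by (simp add: submodule_def)
  next
    case (add m k y)
    then have "y * s + (m * k) * s \<in> localize R N N"
      using loc half[OF add(1,2) s(2)] unfolding submodule_def by blast
    then show ?case by (simp add: distrib_right)
  qed
  then obtain t where "t \<in> R - N" "t * (s * s) \<in> N" unfolding localize_def by blast
  then show False using tMax_prime[OF N] s(1) by blast
qed

end

section \<open>Finite character\<close>

theorem w_stable_imp_t_finite_character:
  assumes stable: "w_stable R"
  shows "t_finite_character R"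
  unfolding t_finite_character_def
proof (intro ballI impI)
  fix x assume x: "x \<in> R" "x \<noteq> 0"
  let ?C = "{M \<in> tMax R. x \<in> M}"
  let ?G = inverse_hull
  show "finite ?C"
  proof (rule ccontr)
    assume inf: "infinite ?C"
    \<comment> \<open>Since \<open>x\<close> lies in every \<open>N\<close> of \<open>?C\<close>,
      multiplication by \<open>x * x\<close> carries each hull into \<open>N\<close> and hence into
      \<open>R\<close>.\<close>
    define z where "z = x * x"
    have z: "z \<noteq> 0" using x by (simp add: z_def)
    \<comment> \<open>\<open>I\<close> is \<open>x\<^sup>2\<close> times the sum of the hulls of all \<open>N \<in> C\<close>, described by local conditions.\<close>
    define I where "I = {a \<in> R. (\<forall>N\<in>?C. a / z \<in> localize R N (?G N)) \<and>
      finite {N \<in> ?C. a / z \<notin> localize R N R}}"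
    have locG: "submodule R (localize R N (?G N))" "localize R N R \<subseteq> localize R N (?G N)"
      if "N \<in> ?C" for N
      using that submodule_localize[OF _ submodule_inverse_hull] localize_mono[OF subset_inverse_hull(1)] by auto
    have locR: "submodule R (localize R N R)" if "N \<in> ?C" for N
      using that submodule_localize[OF _ submodule_self] by auto
    have IR: "I \<subseteq> R" by (auto simp: I_def)
    have I: "submodule R I"
      unfolding submodule_def
    proof (intro conjI ballI)
      have "{N \<in> ?C. 0 / z \<notin> localize R N R} = {}" using locR by (auto simp: submodule_def)
      then have "finite {N \<in> ?C. 0 / z \<notin> localize R N R}" by (metis finite.emptyI)
      moreover have "\<forall>N\<in>?C. 0 / z \<in> localize R N (?G N)" using locG(1) by (simp add: submodule_def)
      ultimately show "0 \<in> I" by (simp add: I_def)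
      fix a assume a: "a \<in> I"
      {
        fix b assume b: "b \<in> I"
        have "{N \<in> ?C. (a + b) / z \<notin> localize R N R} \<subseteq>
            {N \<in> ?C. a / z \<notin> localize R N R} \<union> {N \<in> ?C. b / z \<notin> localize R N R}"
          using locR by (auto simp: submodule_def add_divide_distrib)
        then have "finite {N \<in> ?C. (a + b) / z \<notin> localize R N R}"
          using a b unfolding I_def by (auto elim: finite_subset)
        moreover have "\<forall>N\<in>?C. (a + b) / z \<in> localize R N (?G N)"
          using a b locG(1) unfolding I_def by (auto simp: submodule_def add_divide_distrib)
        ultimately show "a + b \<in> I" using a b by (simp add: I_def add_R)
      next
        fix r assume r: "r \<in> R"
        have "{N \<in> ?C. r * a / z \<notin> localize R N R} \<subseteq> {N \<in> ?C. a / z \<notin> localize R N R}"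
          using locR r by (auto simp: submodule_def simp flip: times_divide_eq_right)
        then have "finite {N \<in> ?C. r * a / z \<notin> localize R N R}"
          using a unfolding I_def by (auto elim: finite_subset)
        moreover have "\<forall>N\<in>?C. r * a / z \<in> localize R N (?G N)"
          using a r locG(1) unfolding I_def by (auto simp: submodule_def simp flip: times_divide_eq_right)
        ultimately show "r * a \<in> I" using a r by (simp add: I_def mult_R)
      }
    qed
    \<comment> \<open>Away from \<open>N\<close> the hull of \<open>N\<close> is locally inside
      \<open>R\<close>, so \<open>N\<close> is the only possible exception in the finiteness
      condition of \<open>I\<close>.\<close>
    have GI: "z * b \<in> I" if N: "N \<in> ?C" and b: "b \<in> ?G N" for N b
    proof -
      have zb: "z * b \<in> R" "z * b / z = b" using z inverse_hull_mult[of N b x x] N b tMaxD(3)[of N] by (auto simp: z_def)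
      have other: "b \<in> localize R M R" if "M \<in> ?C" "M \<noteq> N" for M
        using inverse_hull_localize[of N b M] that N b by auto
      have "b \<in> localize R N (?G N)" using subset_localize[of N] N b by auto
      then have "\<forall>M\<in>?C. b \<in> localize R M (?G M)" using other locG(2) by blast
      moreover have "{M \<in> ?C. b \<notin> localize R M R} \<subseteq> {N}" using other by blast
      then have "finite {M \<in> ?C. b \<notin> localize R M R}" by (rule finite_subset) simp
      ultimately show ?thesis using zb by (simp add: I_def)
    qed
    have "?C \<noteq> {}" using inf by (metis finite.emptyI)
    then obtain N0 where N0: "N0 \<in> ?C" by blast
    have "1 \<in> ?G N0" using subset_inverse_hull(1)[of N0] N0 one_R by blast
    then have zI: "z \<in> I" using GI[OF N0, of 1] by simp
    define W where "W = wop R I"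
    have W: "submodule R W" "I \<subseteq> W" "W \<subseteq> R" "wop R W = W"
      using submodule_wop[OF I] subset_wop[OF I] wop_mono[OF I submodule_self IR] wop_wop[OF I]
      by (simp_all add: W_def wop_self)
    have wW: "w_ideal R W" using W zI z by (intro w_idealI[of W z]) auto
    define H where "H = colon (Eend W) W"
    have H: "h * a * b \<in> W" if "h \<in> H" "a \<in> W" "b \<in> W" for h a b
      using that unfolding H_def colon_Eend by blast
    have IH: "submodule R (mprod I H)" by (rule submodule_mprod[OF I])
    \<comment> \<open>Stability applies to the \<open>w\<close>-closure \<open>W\<close>, but finite
      sums over \<open>I\<close> itself are wanted. Locally \<open>W\<close> and \<open>I\<close>
      agree, and a further denominator \<open>t\<close> replaces factors from \<open>W\<close> by
      factors from \<open>I\<close>.\<close>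
    have "contains_dense R (R \<inter> mprod I H)"
    proof (rule contains_denseI)
      show "submodule R (R \<inter> mprod I H)" using IH submodule_self by (simp add: submodule_def)
      have "1 \<in> H" using W(1,3) unfolding H_def colon_Eend submodule_def by auto
      then have "z * 1 \<in> mprod I H" using zI by (intro mprodI)
      then show "R \<inter> mprod I H \<noteq> {0}" using z zI IR by auto
      fix M assume M: "M \<in> tMax R"
      obtain s where s: "s \<in> R - M" "s \<in> mprod W H"
        using stable w_stable_ideal_iff[OF wW] wW M unfolding w_stable_def H_def by blast
      have "mprod W H \<subseteq> localize R M (mprod I H)"
      proof (rule mprod_subset[OF submodule_localize[OF M IH]])
        fix a h assume ah: "a \<in> W" "h \<in> H"
        then obtain t where t: "t \<in> R - M" "t * a \<in> I"
          using M unfolding W_def wop_eq[OF I] localize_def by blast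
        then have "t * a * h \<in> mprod I H" using ah by (intro mprodI)
        then show "a * h \<in> localize R M (mprod I H)"
          using t by (intro localizeI[of t]) (simp_all add: mult.assoc)
      qed
      then obtain t where t: "t \<in> R - M" "t * s \<in> mprod I H"
        using s(2) unfolding localize_def by blast
      then show "\<exists>s\<in>R - M. s \<in> R \<inter> mprod I H" using tMax_prime[OF M t(1) s(1)] by blast
    qed simp
    then obtain S where S: "finite S" "S \<subseteq> R" "S \<subseteq> mprod I H" "colon R S \<subseteq> R"
      unfolding contains_dense_def by blast
    define X where "X N = {a \<in> I. a / z \<in> localize R N R}" for N
    \<comment> \<open>Only finitely many elements of \<open>I\<close> occur in an expression of
      \<open>s\<close>, and each is outside \<open>X N\<close> for only finitely many
      \<open>N\<close> of \<open>?C\<close>.\<close>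
    have "finite {N \<in> ?C. s \<notin> mprod (X N) H}" if "s \<in> S" for s
    proof -
      have "s \<in> mprod I H" using that S(3) by blast
      then show ?thesis
      proof (induction rule: mprod_induct)
        case zero
        then show ?case by (simp add: zero_in_mprod)
      next
        case (add a h y)
        have "{N \<in> ?C. y + a * h \<notin> mprod (X N) H} \<subseteq>
            {N \<in> ?C. y \<notin> mprod (X N) H} \<union> {N \<in> ?C. a / z \<notin> localize R N R}"
          using add(1,2) by (auto intro!: mprod_add mprodI simp: X_def)
        moreover have "finite {N \<in> ?C. a / z \<notin> localize R N R}" using add(1) by (simp add: I_def)
        ultimately show ?case using add.IH finite_subset by blast
      qed
    qed
    then have "finite (\<Union>s\<in>S. {N \<in> ?C. s \<notin> mprod (X N) H})" using S(1) by blast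
    then obtain N where N: "N \<in> ?C" and SN: "\<And>s. s \<in> S \<Longrightarrow> s \<in> mprod (X N) H"
      using inf by (smt (verit) UN_iff finite_subset mem_Collect_eq subsetI)
    have NM: "N \<in> tMax R" using N by simp
    have "\<not> S \<subseteq> N" using tMaxD(5)[OF NM] S unfolding contains_dense_def by blast
    then obtain s where s: "s \<in> S" "s \<in> R - N" using S(2) by blast
    have "b * c \<in> localize R N (?G N)" if bc: "b \<in> ?G N" "c \<in> ?G N" for b c
    proof -
      have "s \<in> mprod (X N) H" by (rule SN[OF s(1)])
      then have "s * (b * c) \<in> localize R N (?G N)"
      proof (induction rule: mprod_induct)
        case zero
        then show ?case using locG(1)[OF N] by (simp add: submodule_def)
      next
        case (add a h y)
        \<comment> \<open>The element \<open>s * (b * c)\<close> is a sum of terms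
          \<open>a / z * (w / z)\<close>. The first factor is in the localisation of
          \<open>R\<close> at \<open>N\<close> by the choice of \<open>N\<close>; the second is in
          the localised hull because \<open>w\<close> lies in \<open>W\<close>, which is locally
          \<open>I\<close>.\<close>
        define w where "w = h * (z * b) * (z * c)"
        have "w \<in> W" unfolding w_def using add(2) GI[OF N] bc W(2) by (intro H) auto
        then obtain u where u: "u \<in> R - N" "u * w \<in> I"
          using NM unfolding W_def wop_eq[OF I] localize_def by blast
        then have "u * w / z \<in> localize R N (?G N)" using N unfolding I_def by blast
        then have "w / z \<in> localize R N (?G N)"
          using localize_localize[OF NM u(1)] by simp
        moreover have "a / z \<in> localize R N R" using add(1) by (simp add: X_def)
        ultimately have "a / z * (w / z) \<in> localize R N (?G N)"
          using localize_mult[OF NM submodule_inverse_hull[OF NM]] by blast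
        moreover have "a / z * (w / z) = a * h * (b * c)" using z by (simp add: w_def)
        ultimately have "y * (b * c) + a * h * (b * c) \<in> localize R N (?G N)"
          using add.IH locG(1)[OF N] by (simp add: submodule_def)
        then show ?case by (simp add: distrib_right)
      qed
      then show ?thesis by (rule localize_localize[OF NM s(2)])
    qed
    then show False using inverse_hull_not_ring[OF NM stable] by blast
  qed
qed

section \<open>From local stability and finite character to \<open>w\<close>-stability\<close>

text \<open>Write \<open>1\<close> as a sum of products \<open>a * b\<close> with
  \<open>a \<in> J\<close> and \<open>b \<in> (E(J) : J)\<close>. If \<open>y\<close> sends every
  \<open>a\<close> into \<open>J\<close>, then \<open>y * u\<close> is a sum of elements
  \<open>b * (y * a) * u\<close> of \<open>J\<close>. Thus finitely many \<open>a\<close>, cleared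
  of denominators, detect membership in \<open>E(J)\<close>.\<close>

lemma locally_finitely_generated:
  assumes N: "N \<in> tMax R" and st: "stable_domain (loc R N)" and I: "nz_ideal R I"
  defines "J \<equiv> localize R N I"
  shows "1 \<in> mprod J (colon (Eend J) J)"
    and "\<exists>F. finite F \<and> F \<subseteq> I \<and> (\<forall>y. (\<forall>f\<in>F. y * f \<in> J) \<longrightarrow> (\<forall>u\<in>J. y * u \<in> J))"
proof -
  have sI: "submodule R I" "I \<subseteq> R" "I \<noteq> {0}" using I by (simp_all add: nz_ideal_def nonzero_submodule_def)
  have sJ: "submodule R J" unfolding J_def by (rule submodule_localize[OF N sI(1)])
  have "I \<subseteq> J" unfolding J_def by (rule subset_localize[OF N])
  then have "J \<noteq> {0}" using sI(1,3) by (auto simp: submodule_def)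
  moreover have "J \<subseteq> loc R N" unfolding J_def loc_eq_localize[OF N] by (rule localize_mono[OF sI(2)])
  moreover have "submodule (loc R N) J"
    using sJ localize_mult[OF N sI(1)] unfolding submodule_def loc_eq_localize[OF N] J_def by blast
  ultimately have "nz_ideal (loc R N) J" by (simp add: nz_ideal_def nonzero_submodule_def)
  then have "mprod J (colon (Eend J) J) = Eend J" using st by (simp add: stable_domain_def)
  then show one: "1 \<in> mprod J (colon (Eend J) J)" by (simp add: Eend_def colon_def)
  \<comment> \<open>The factor \<open>1\<close> is kept visible so that it can be replaced by a
    partial sum \<open>w\<close> in the induction.\<close>
  have "\<exists>F. finite F \<and> F \<subseteq> I \<and> (\<forall>y. (\<forall>f\<in>F. y * f \<in> J) \<longrightarrow> (\<forall>u\<in>J. y * 1 * u \<in> J))"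
    using one
  proof (induction rule: mprod_induct[where P = "\<lambda>w. \<exists>F. finite F \<and> F \<subseteq> I \<and>
      (\<forall>y. (\<forall>f\<in>F. y * f \<in> J) \<longrightarrow> (\<forall>u\<in>J. y * w * u \<in> J))"])
    case zero
    then show ?case using sJ by (intro exI[of _ "{}"]) (simp add: submodule_def)
  next
    case (add a b w)
    obtain F where F: "finite F" "F \<subseteq> I" "\<And>y u. (\<forall>f\<in>F. y * f \<in> J) \<Longrightarrow> u \<in> J \<Longrightarrow> y * w * u \<in> J"
      using add(4) by blast
    obtain s where s: "s \<in> R - N" "s * a \<in> I" using add(1) unfolding J_def localize_def by blast
    show ?case
    proof (intro exI[of _ "insert (s * a) F"] conjI allI impI ballI)
      fix y u assume y: "\<forall>f\<in>insert (s * a) F. y * f \<in> J" and u: "u \<in> J"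
      have "s * (y * a) \<in> J" using y by (simp add: mult.left_commute)
      then have "y * a \<in> J" unfolding J_def by (rule localize_localize[OF N s(1)])
      then have "b * (y * a) * u \<in> J" using add(2) u unfolding colon_Eend by blast
      moreover have "y * w * u \<in> J" using y u by (intro F(3)) auto
      ultimately have "y * w * u + b * (y * a) * u \<in> J" using sJ by (simp add: submodule_def)
      then show "y * (w + a * b) * u \<in> J" by (simp add: algebra_simps)
    qed (use F s in auto)
  qed
  then show "\<exists>F. finite F \<and> F \<subseteq> I \<and> (\<forall>y. (\<forall>f\<in>F. y * f \<in> J) \<longrightarrow> (\<forall>u\<in>J. y * u \<in> J))" by simp
qed

theorem locally_stable_imp_w_stable:
  assumes fin: "t_finite_character R" and st: "\<And>M. M \<in> tMax R \<Longrightarrow> stable_domain (loc R M)"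
  shows "w_stable R"
  unfolding w_stable_def
proof (intro allI impI)
  fix I assume wI: "w_ideal R I"
  note I = w_idealD[OF wI]
  have nzI: "nz_ideal R I" using wI by (simp add: w_ideal_def)
  let ?L = "\<lambda>N. localize R N I"
  obtain c where c: "c \<in> I" "c \<noteq> 0" using I(4) by blast
  let ?C = "{N \<in> tMax R. c \<in> N}"
  have finC: "finite ?C" using fin c I(2) by (auto simp: t_finite_character_def)
  have "\<forall>N\<in>?C. \<exists>F. finite F \<and> F \<subseteq> I \<and> (\<forall>y. (\<forall>f\<in>F. y * f \<in> ?L N) \<longrightarrow> (\<forall>u\<in>?L N. y * u \<in> ?L N))"
    using locally_finitely_generated(2)[OF _ st nzI] by blast
  from bchoice[OF this] obtain F where F: "\<forall>N\<in>?C. finite (F N) \<and> F N \<subseteq> I \<and>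
      (\<forall>y. (\<forall>f\<in>F N. y * f \<in> ?L N) \<longrightarrow> (\<forall>u\<in>?L N. y * u \<in> ?L N))" ..
  \<comment> \<open>Finite character leaves finitely many \<open>N\<close> containing
    \<open>c\<close>, each contributing its own test set. At every other \<open>N\<close> the
    element \<open>c\<close> is a unit and suffices alone.\<close>
  define G where "G = insert c (\<Union>N\<in>?C. F N)"
  have G: "finite G" "G \<subseteq> I" using finC F c unfolding G_def by blast+
  have span: "y * u \<in> ?L N" if N: "N \<in> tMax R" and y: "\<And>f. f \<in> G \<Longrightarrow> y * f \<in> ?L N" and u: "u \<in> ?L N" for N y u
  proof (cases "c \<in> N")
    case True
    then have C: "N \<in> ?C" using N by simp
    then have "\<forall>f\<in>F N. y * f \<in> ?L N" by (intro ballI y) (auto simp: G_def)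
    then show ?thesis using bspec[OF F C] u by blast
  next
    case False
    have "y * c \<in> localize R N R" using y[of c] localize_mono[OF I(2)] by (auto simp: G_def)
    then have "y \<in> localize R N R"
      using localize_localize[OF N, of c y] False c(1) I(2) by (auto simp: mult.commute)
    then show ?thesis using u by (rule localize_mult[OF N I(1)])
  qed
  show "w_stable_ideal R I"
    unfolding w_stable_ideal_iff[OF wI]
  proof
    fix M assume M: "M \<in> tMax R"
    let ?K = "colon (Eend I) I"
    have J: "submodule R (mprod I ?K)" by (rule submodule_mprod[OF I(1)])
    have "mprod (?L M) (colon (Eend (?L M)) (?L M)) \<subseteq> localize R M (mprod I ?K)"
    proof (rule mprod_subset[OF submodule_localize[OF M J]])
      fix a b assume a: "a \<in> ?L M" and b: "b \<in> colon (Eend (?L M)) (?L M)"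
      obtain s where s: "s \<in> R - M" "s * a \<in> I" using a unfolding localize_def by blast
      \<comment> \<open>A single \<open>t\<close> clears the finitely many elements
        \<open>b * f * g\<close>; this turns the local inverse element \<open>b\<close> into the
        global one \<open>t * b\<close>.\<close>
      let ?P = "(\<lambda>(f, g). b * f * g) ` (G \<times> G)"
      have "?P \<subseteq> ?L M"
        using b G(2) subset_localize[OF M, of I] unfolding colon_Eend by auto
      then obtain t where t: "t \<in> R - M" "\<forall>p\<in>?P. t * p \<in> I"
        using common_denominator[OF M I(1), of ?P] G(1) by blast
      have "t * b \<in> ?K"
        unfolding colon_Eend
      proof (intro ballI)
        fix u v assume uv: "u \<in> I" "v \<in> I"
        \<comment> \<open>\<open>span\<close> is used twice at each \<open>N\<close>: first to pass
          from \<open>f \<in> G\<close> to \<open>u\<close> with \<open>g\<close> fixed, then from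
          \<open>g \<in> G\<close> to \<open>v\<close> with \<open>u\<close> fixed.\<close>
        have "t * b * u * v \<in> wop R I"
          unfolding wop_eq[OF I(1)]
        proof
          fix N assume N: "N \<in> tMax R"
          note sub = subset_localize[OF N, of I]
          have fg: "t * b * g * f \<in> ?L N" if "f \<in> G" "g \<in> G" for f g
          proof -
            have "t * (b * g * f) \<in> I" using t(2) that by force
            then show ?thesis using sub by (auto simp: mult.assoc)
          qed
          have "t * b * u * g \<in> ?L N" if g: "g \<in> G" for g
          proof -
            have "t * b * g * u \<in> ?L N"
              by (rule span[OF N]) (use fg[OF _ g] uv sub in auto)
            then show ?thesis by (simp add: mult_ac)
          qed
          then show "t * b * u * v \<in> ?L N"
            by (rule span[OF N]) (use uv sub in auto)
        qed
        then show "t * b * u * v \<in> I" using I(3) by simp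
      qed
      then have "(s * a) * (t * b) \<in> mprod I ?K" using s(2) by (intro mprodI)
      then have "(s * t) * (a * b) \<in> mprod I ?K" by (simp add: mult_ac)
      then show "a * b \<in> localize R M (mprod I ?K)"
        by (rule localizeI[OF tMax_prime[OF M s(1) t(1)]])
    qed
    then have "1 \<in> localize R M (mprod I ?K)"
      using locally_finitely_generated(1)[OF M st[OF M] nzI] by blast
    then show "\<exists>s\<in>R - M. s \<in> mprod I ?K" by (simp add: localize_def)
  qed
qed

end

theorem theorem2p2:
  fixes R :: "'a::field set"
  assumes "subring R" and "is_quotient_field R" and "R \<noteq> UNIV"
  shows "(w_stable R \<longleftrightarrow>
            (\<forall>I. w_ideal R I \<longrightarrow> colon (Eend I) (colon (Eend I) I) = I))
       \<and> ((\<forall>I. w_ideal R I \<longrightarrow> colon (Eend I) (colon (Eend I) I) = I) \<longleftrightarrow>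
            (t_finite_character R \<and> (\<forall>M\<in>tMax R. stable_domain (loc R M))))"
proof -
  interpret domain_with_fractions R
    using assms by unfold_locales
  have "w_stable R \<longleftrightarrow> (\<forall>I. w_ideal R I \<longrightarrow> colon (Eend I) (colon (Eend I) I) = I)"
    using w_stable_imp_divisorial divisorial_imp_w_stable by blast
  moreover have "w_stable R \<longleftrightarrow> t_finite_character R \<and> (\<forall>M\<in>tMax R. stable_domain (loc R M))"
    using w_stable_imp_t_finite_character w_stable_imp_stable_loc locally_stable_imp_w_stable by blast
  ultimately show ?thesis by simp
qed

end
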